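(* Let $A$ be a finite set of atoms and $P$ a propositional Horn theory over $A$. Then the least model of $P$ satisfies $$LM(P)=P^\omega,$$ where $P^\omega=P^+\circ\emptyset$ (equivalently, the set of facts of $P^+$), $P^+=P^\ast\circ P$ and $P^\ast=\bigcup_{n\ge0}P^n$.
   Context: A theory over $A$ is a finite set of rules $a_0\leftarrow a_1,\ldots,a_k$ ($k\ge0$, $a_i\in A$), with $head(r)=\{a_0\}$, $body(r)=\{a_1,\ldots,a_k\}$, size $k$; for a set $S$ of rules $head(S),body(S)$ are the unions of heads and bodies. A fact is a rule with empty body; interpretations (subsets of $A$) are identified with theories consisting of facts. Write $S\subseteq_r R$ if $S\subseteq R$ has as many elements as the size of $r$. Composition: $P\circ R=\{head(r)\leftarrow body(S)\mid r\in P,\ S\subseteq_r R,\ head(S)=body(r)\}$. Powers: $P^0=1_A=\{a\leftarrow a\mid a\in A\}$ and $P^{n+1}=P^n\circ P$. An interpretation $I$ is a model of $P$ if for every rule $r\in P$, $body(r)\subseteq I$ implies $head(r)\subseteq I$; $LM(P)$ is the least model of $P$ with respect to set inclusion. *)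

theory Defs
  imports Main
begin

text \<open>
  The body of a rule is a set, as it has to be for \<open>head(r) \<leftarrow> body(S)\<close> in the definition of
  composition to be a rule again; so the body atoms \<open>a\<^sub>1, \<dots>, a\<^sub>k\<close> are pairwise distinct and the
  size \<open>k\<close> is the cardinality of the body.
\<close>

datatype 'a rule = Rule (head_atom: 'a) (body: "'a set")

definition head :: "'a rule \<Rightarrow> 'a set" where
  "head r = {head_atom r}"

definition rule_size :: "'a rule \<Rightarrow> nat" where
  "rule_size r = card (body r)"

definition heads :: "'a rule set \<Rightarrow> 'a set" where
  "heads S = (\<Union>r\<in>S. head r)"

definition bodies :: "'a rule set \<Rightarrow> 'a set" where
  "bodies S = (\<Union>r\<in>S. body r)"

definition horn_theory :: "'a set \<Rightarrow> 'a rule set \<Rightarrow> bool" where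
  "horn_theory A P \<longleftrightarrow> finite P \<and> (\<forall>r\<in>P. finite (body r) \<and> head r \<subseteq> A \<and> body r \<subseteq> A)"

text \<open>The theory of facts with which an interpretation is identified.\<close>

definition facts_of :: "'a set \<Rightarrow> 'a rule set" where
  "facts_of I = (\<lambda>a. Rule a {}) ` I"

text \<open>
  The relation \<open>S \<subseteq>\<^sub>r R\<close>. Finiteness is explicit because \<^const>\<open>card\<close> is 0 on infinite sets.
\<close>

definition subset_of_size :: "'a rule \<Rightarrow> 'a rule set \<Rightarrow> 'a rule set \<Rightarrow> bool" where
  "subset_of_size r S R \<longleftrightarrow> S \<subseteq> R \<and> finite S \<and> card S = rule_size r"

definition horn_comp :: "'a rule set \<Rightarrow> 'a rule set \<Rightarrow> 'a rule set"  (infixl "\<circ>\<^sub>H" 70) where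
  "P \<circ>\<^sub>H R =
     {Rule (head_atom r) (bodies S) | r S. r \<in> P \<and> subset_of_size r S R \<and> heads S = body r}"

definition horn_unit :: "'a set \<Rightarrow> 'a rule set" where
  "horn_unit A = {Rule a {a} | a. a \<in> A}"

primrec horn_power :: "'a set \<Rightarrow> 'a rule set \<Rightarrow> nat \<Rightarrow> 'a rule set" where
  "horn_power A P 0 = horn_unit A"
| "horn_power A P (Suc n) = horn_power A P n \<circ>\<^sub>H P"

definition horn_star :: "'a set \<Rightarrow> 'a rule set \<Rightarrow> 'a rule set" where
  "horn_star A P = (\<Union>n. horn_power A P n)"

definition horn_plus :: "'a set \<Rightarrow> 'a rule set \<Rightarrow> 'a rule set" where
  "horn_plus A P = horn_star A P \<circ>\<^sub>H P"

definition horn_omega :: "'a set \<Rightarrow> 'a rule set \<Rightarrow> 'a rule set" where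
  "horn_omega A P = horn_plus A P \<circ>\<^sub>H {}"

definition is_model :: "'a set \<Rightarrow> 'a rule set \<Rightarrow> 'a set \<Rightarrow> bool" where
  "is_model A P I \<longleftrightarrow> I \<subseteq> A \<and> (\<forall>r\<in>P. body r \<subseteq> I \<longrightarrow> head r \<subseteq> I)"

definition LM :: "'a set \<Rightarrow> 'a rule set \<Rightarrow> 'a set" where
  "LM A P = (LEAST I. is_model A P I)"

text \<open>The operator \<^const>\<open>Least\<close> is well defined here: a least model does exist.\<close>

lemma LM_is_least_model:
  assumes "horn_theory A P"
  shows "is_model A P (LM A P)" and "is_model A P J \<Longrightarrow> LM A P \<subseteq> J"
proof -
  let ?M = "\<Inter> {I. is_model A P I}"
  have "is_model A P A"
    using assms by (auto simp: is_model_def horn_theory_def)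
  then have "is_model A P ?M"
    unfolding is_model_def by blast
  moreover have "?M \<subseteq> I" if "is_model A P I" for I
    using that by blast
  ultimately have "LM A P = ?M"
    unfolding LM_def by (intro Least_equality) auto
  with \<open>is_model A P ?M\<close> show "is_model A P (LM A P)" and "is_model A P J \<Longrightarrow> LM A P \<subseteq> J"
    by auto
qed

lemma horn_omega_eq_facts: "horn_omega A P = {r \<in> horn_plus A P. body r = {}}"
proof -
  have empty: "subset_of_size r S {} \<and> heads S = body r \<longleftrightarrow> S = {} \<and> body r = {}" 
    for r :: "'a rule" and S
    by (auto simp: subset_of_size_def heads_def rule_size_def)
  have "Rule (head_atom r) (bodies {}) = r" if "body r = {}" for r :: "'a rule"
    using that by (cases r) (simp add: bodies_def)
  moreover have "body (Rule a (bodies {})) = {}" for a :: 'a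
    by (simp add: bodies_def)
  ultimately show ?thesis
    unfolding horn_omega_def horn_comp_def[of "horn_plus A P"] empty by auto metis
qed

end

theory Submission
  imports Defs
begin

text \<open>
  Every rule of every power of \<open>P\<close> is sound for the models of \<open>P\<close>, so the facts of \<open>P\<^sup>+\<close> lie in
  the least model.  Conversely, let \<open>T\<close> be the immediate consequence operator. If \<open>B \<subseteq> T\<^sup>n\<^sup>+\<^sup>1 {}\<close>
  and \<open>a \<leftarrow> B\<close> is in \<open>P\<^sup>m\<close>, then resolving each atom of \<open>B\<close> with one rule of \<open>P\<close> gives a rule
  \<open>a \<leftarrow> B'\<close> of \<open>P\<^sup>m\<^sup>+\<^sup>1\<close> with \<open>B' \<subseteq> T\<^sup>n {}\<close>. Starting from \<open>a \<leftarrow> a\<close> in \<open>P\<^sup>0\<close>, this reaches the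
  fact \<open>a\<close>; branches of different depth are no obstacle, because a resolved fact leaves no atoms
  behind.
\<close>

definition sound_for :: "'a set \<Rightarrow> 'a rule set \<Rightarrow> bool" where
  "sound_for I R \<longleftrightarrow> (\<forall>r\<in>R. body r \<subseteq> I \<longrightarrow> head_atom r \<in> I)"

text \<open>If \<open>bodies S\<close> holds in \<open>I\<close>, soundness of \<open>Q\<close> puts
  \<open>heads S\<close> in \<open>I\<close>; this is the body of \<open>r\<close>, so soundness of
  \<open>R\<close> applies.\<close>

lemma sound_for_horn_comp:
  assumes "sound_for I R" "sound_for I Q"
  shows "sound_for I (R \<circ>\<^sub>H Q)"
proof -
  have "head_atom r \<in> I"
    if "r \<in> R" "S \<subseteq> Q" "heads S = body r" "bodies S \<subseteq> I" for r S
  proof -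
    have "head_atom s \<in> I" if "s \<in> S" for s
    proof -
      have "body s \<subseteq> I"
        using \<open>bodies S \<subseteq> I\<close> \<open>s \<in> S\<close> by (auto simp: bodies_def)
      then show ?thesis
        using assms(2) \<open>S \<subseteq> Q\<close> \<open>s \<in> S\<close> by (auto simp: sound_for_def)
    qed
    then have "heads S \<subseteq> I"
      by (auto simp: heads_def head_def)
    then show ?thesis
      using that assms(1) unfolding sound_for_def by simp
  qed
  then show ?thesis
    by (auto simp: sound_for_def horn_comp_def subset_of_size_def)
qed

lemma sound_for_model: "is_model A P I \<Longrightarrow> sound_for I P"
  by (auto simp: is_model_def sound_for_def head_def)

lemma sound_for_horn_plus:
  assumes "is_model A P I"
  shows "sound_for I (horn_plus A P)"
proof -
  note P = sound_for_model[OF assms]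
  have "sound_for I (horn_power A P n)" for n
  proof (induction n)
    case 0
    show ?case by (auto simp: sound_for_def horn_unit_def)
  next
    case (Suc n)
    then show ?case by (simp add: sound_for_horn_comp P)
  qed
  then have "sound_for I (horn_star A P)"
    by (auto simp: sound_for_def horn_star_def)
  then show ?thesis
    unfolding horn_plus_def by (rule sound_for_horn_comp[OF _ P])
qed

text \<open>The iterate \<open>T\<^sup>n {}\<close> of the immediate consequence operator.\<close>

primrec horn_stage :: "'a rule set \<Rightarrow> nat \<Rightarrow> 'a set" where
  "horn_stage P 0 = {}"
| "horn_stage P (Suc n) = head_atom ` {r \<in> P. body r \<subseteq> horn_stage P n}"

lemma mono_horn_stage: "mono (horn_stage P)"
proof (rule mono_iff_le_Suc[THEN iffD2], rule allI)
  show "horn_stage P n \<subseteq> horn_stage P (Suc n)" for n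
    by (induction n) auto
qed

lemma finite_subset_UN_mono:
  fixes T :: "nat \<Rightarrow> 'a set"
  assumes "finite B" "mono T" "B \<subseteq> (\<Union>n. T n)"
  shows "\<exists>n. B \<subseteq> T n"
  using assms(1,3)
proof (induction B)
  case (insert b B)
  then obtain m n where "B \<subseteq> T m" "b \<in> T n" by blast
  then have "insert b B \<subseteq> T (max m n)"
    using monoD[OF assms(2), of m "max m n"] monoD[OF assms(2), of n "max m n"] by auto
  then show ?case ..
qed simp

text \<open>Bodies are finite and the stages increase, so a body inside the union already lies in a
  single stage, and its head in the next one. By leastness, every atom of \<open>LM A P\<close> then
  appears at some stage.\<close>

lemma is_model_horn_stage:
  assumes "horn_theory A P"
  shows "is_model A P (\<Union>n. horn_stage P n)"
proof -
  have "horn_stage P n \<subseteq> A" for n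
    using assms by (cases n) (auto simp: horn_theory_def head_def)
  moreover have "head_atom r \<in> (\<Union>n. horn_stage P n)"
    if "r \<in> P" and sub: "body r \<subseteq> (\<Union>n. horn_stage P n)" for r
  proof -
    have "finite (body r)"
      using assms \<open>r \<in> P\<close> by (auto simp: horn_theory_def)
    then obtain n where "body r \<subseteq> horn_stage P n"
      using finite_subset_UN_mono[OF _ mono_horn_stage sub] by blast
    then have "head_atom r \<in> horn_stage P (Suc n)"
      using \<open>r \<in> P\<close> by auto
    then show ?thesis by blast
  qed
  ultimately show ?thesis
    unfolding is_model_def head_def by blast
qed

text \<open>As \<open>f b\<close> has head \<open>b\<close>, \<open>f\<close> is injective on
  \<open>B\<close>; its image has exactly \<open>card B\<close> elements, which is the size that
  composition demands.\<close>

lemma horn_comp_choice: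
  assumes "Rule a B \<in> R" "finite B" "\<And>b. b \<in> B \<Longrightarrow> f b \<in> P \<and> head_atom (f b) = b"
  shows "Rule a (\<Union>b\<in>B. body (f b)) \<in> R \<circ>\<^sub>H P"
proof -
  have "inj_on f B"
    by (metis assms(3) inj_onI)
  then have "subset_of_size (Rule a B) (f ` B) P"
    using assms by (auto simp: subset_of_size_def rule_size_def card_image)
  moreover have "heads (f ` B) = body (Rule a B)"
    using assms(3) by (auto simp: heads_def head_def)
  moreover have "bodies (f ` B) = (\<Union>b\<in>B. body (f b))"
    by (auto simp: bodies_def)
  ultimately show ?thesis
    using assms(1) unfolding horn_comp_def
    by (intro CollectI exI[of _ "Rule a B"] exI[of _ "f ` B"]) simp
qed

text \<open>Each resolution raises the power by one and lowers the stage by one, so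
  \<open>m + n\<close> is invariant. At stage 0 the body is empty and the rule is the fact
  itself.\<close>

lemma fact_in_horn_power:
  assumes "\<And>r. r \<in> P \<Longrightarrow> finite (body r)"
    and "Rule a B \<in> horn_power A P m" "finite B" "B \<subseteq> horn_stage P n"
  shows "Rule a {} \<in> horn_power A P (m + n)"
  using assms(2-)
proof (induction n arbitrary: m B)
  case (Suc n)
  have "\<forall>b\<in>B. \<exists>r. r \<in> P \<and> head_atom r = b \<and> body r \<subseteq> horn_stage P n"
    using Suc.prems(3) by auto
  then obtain f where f: "\<And>b. b \<in> B \<Longrightarrow> f b \<in> P \<and> head_atom (f b) = b"
      "\<And>b. b \<in> B \<Longrightarrow> body (f b) \<subseteq> horn_stage P n"
    by metis
  let ?B = "\<Union>b\<in>B. body (f b)"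
  have "Rule a ?B \<in> horn_power A P (Suc m)"
    using horn_comp_choice[OF Suc.prems(1,2) f(1)] by simp
  moreover have "finite ?B"
    using Suc.prems(2) f(1) assms(1) by simp
  moreover have "?B \<subseteq> horn_stage P n"
    using f(2) by blast
  ultimately have "Rule a {} \<in> horn_power A P (Suc m + n)"
    by (rule Suc.IH)
  then show ?case by simp
qed simp

theorem theorem6p7:
  fixes A :: "'a set" and P :: "'a rule set"
  assumes "finite A" and "horn_theory A P"
  shows "facts_of (LM A P) = horn_omega A P"
proof (intro equalityI subsetI)
  fix r assume "r \<in> facts_of (LM A P)"
  then obtain a where r: "r = Rule a {}" and a: "a \<in> LM A P"
    by (auto simp: facts_of_def)
  have "a \<in> A"
    using a LM_is_least_model(1)[OF assms(2)] by (auto simp: is_model_def)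
  then have "Rule a {a} \<in> horn_power A P 0"
    by (simp add: horn_unit_def)
  moreover obtain n where "{a} \<subseteq> horn_stage P n"
    using a LM_is_least_model(2)[OF assms(2) is_model_horn_stage[OF assms(2)]] by auto
  ultimately have "Rule a {} \<in> horn_power A P (0 + n)"
    using assms(2) by (intro fact_in_horn_power) (auto simp: horn_theory_def)
  then have "Rule a {} \<in> horn_star A P"
    by (auto simp: horn_star_def)
  \<comment> \<open>A fact is composed with the empty set of rules of \<open>P\<close>, so it
    survives the last factor.\<close>
  then have "Rule a {} \<in> horn_plus A P"
    using horn_comp_choice[of a "{}"] by (simp add: horn_plus_def)
  then show "r \<in> horn_omega A P"
    by (simp add: r horn_omega_eq_facts)
next
  fix r assume "r \<in> horn_omega A P"
  then have r: "r \<in> horn_plus A P" "body r = {}"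
    by (auto simp: horn_omega_eq_facts)
  \<comment> \<open>The empty body holds in \<open>LM A P\<close> trivially, so soundness yields the
    head.\<close>
  then have "head_atom r \<in> LM A P"
    using sound_for_horn_plus[OF LM_is_least_model(1)[OF assms(2)]]
    by (auto simp: sound_for_def)
  then show "r \<in> facts_of (LM A P)"
    using r(2) by (cases r) (auto simp: facts_of_def)
qed

end
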